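(* For all integers $N\geq 2$ and $M\geq 1$, $$\delta(N,M)\ \geq\ \beta(N,M)=\begin{cases} \dfrac{M-1}{2(N-1)}, & M\leq N-1,\\[2mm] 1-\dfrac{N}{2M}, & M>N-1,\end{cases}$$ where $$\beta(N,M)\asymp\begin{cases} \dfrac{M}{2N}, & M/N\leq 1,\\[2mm] 1-\dfrac{N}{2M}, & M/N>1,\end{cases}\qquad\text{as } N,M\to\infty .$$
   Context: $\Gamma$ denotes the Euler Gamma function and $\Gamma^{(n)}$ its $n$-th derivative; "transcendental" means transcendental over $\mathbb{Q}$. For integers $N\geq 2$, $M\geq 1$, the bivariate density of transcendental values is $$\delta(N,M)=\frac{\#\left\{(n,m)\in\{2,3,\ldots,N\}\times\{1,2,\ldots,M\} : \Gamma^{(n)}(m)\ \text{is transcendental}\right\}}{(N-1)M}.$$ The function $\beta(N,M)$ is defined by the displayed piecewise formula in the claim. The notation $f(N,M)\asymp g(N,M)$ as $N,M\to\infty$ means asymptotic equivalence: $f(N,M)/g(N,M)\to 1$ as $N$ and $M$ both tend to infinity (i.e. as $\min\{N,M\}\to\infty$). *)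

theory Defs
  imports "HOL-Complex_Analysis.Complex_Analysis" "HOL-Library.Landau_Symbols"
begin

text \<open>
  The library's \<^const>\<open>algebraic\<close> asks for a nonzero polynomial with integer coefficients, which is
  the same as algebraic over the rationals (\<open>algebraic_altdef\<close>).
\<close>
definition transcendental :: "complex \<Rightarrow> bool" where
  "transcendental z \<longleftrightarrow> \<not> algebraic z"

definition transc_density :: "nat \<Rightarrow> nat \<Rightarrow> real" where
  "transc_density N M =
     real (card {(n, m). n \<in> {2..N} \<and> m \<in> {1..M} \<and>
                   transcendental ((deriv ^^ n) Gamma (of_nat m))})
       / ((real N - 1) * real M)"

definition density_bound :: "nat \<Rightarrow> nat \<Rightarrow> real" where
  "density_bound N M =
     (if real M \<le> real N - 1 then (real M - 1) / (2 * (real N - 1))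
      else 1 - real N / (2 * real M))"

definition density_bound_asymp :: "nat \<Rightarrow> nat \<Rightarrow> real" where
  "density_bound_asymp N M =
     (if real M / real N \<le> 1 then real M / (2 * real N)
      else 1 - real N / (2 * real M))"

end

theory Submission
  imports Defs "HOL-Computational_Algebra.Fundamental_Theorem_Algebra"
begin

text \<open>
  For each order \<open>n \<ge> 2\<close> at most \<open>n - 1\<close> of the numbers \<open>\<Gamma>\<^sup>(\<^sup>n\<^sup>)(1), \<Gamma>\<^sup>(\<^sup>n\<^sup>)(2), \<dots>\<close> are algebraic
  (\<open>Gamma_derivs_algebraic_card\<close>). Hence at least \<open>max 0 (M - (n - 1))\<close> of the first \<open>M\<close> of them are
  transcendental, and summing over \<open>n\<close> gives exactly \<open>\<beta>(N, M)\<close> times the number of pairs. The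
  asymptotic form of \<open>\<beta>\<close> is elementary: the two functions agree for \<open>M \<ge> N\<close>, and below the diagonal
  their quotient is \<open>(1 - 1/M) (1 + 1/(N - 1))\<close>.

  The bound \<open>n - 1\<close> has an arithmetic and a combinatorial source.

  Arithmetic: \<open>\<Gamma>''(1) = \<Gamma>'(1)\<^sup>2 + \<pi>\<^sup>2/6\<close>, so, \<open>\<pi>\<close> being transcendental, \<open>\<Gamma>'(1)\<close> and \<open>\<Gamma>''(1)\<close> are not
  both algebraic. The algebraic numbers form a rational subspace of the complex numbers, so there is
  a rational-linear functional \<open>\<phi>\<close> that vanishes on all of them but not on both \<open>\<Gamma>'(1)\<close> and \<open>\<Gamma>''(1)\<close>.

  Combinatorial: differentiating \<open>\<Gamma>(z + 1) = z \<Gamma>(z)\<close> and applying \<open>\<phi>\<close> shows that the rational numbers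
  \<open>G\<^sub>k(m) = \<phi>(\<Gamma>\<^sup>(\<^sup>k\<^sup>)(m + 1)) / m!\<close> satisfy \<open>(m + 1) (G\<^sub>k(m + 1) - G\<^sub>k(m)) = k G\<^sub>k\<^sub>-\<^sub>1(m)\<close>. So, up to a positive
  weight, \<open>G\<^sub>k\<^sub>-\<^sub>1\<close> is the difference sequence of \<open>G\<^sub>k\<close>. By a discrete form of Rolle's theorem, if the
  signs of \<open>G\<^sub>k\<close> alternate weakly at \<open>j + 1\<close> points, those of \<open>G\<^sub>k\<^sub>-\<^sub>1\<close> do so at \<open>j\<close> points
  (\<open>alternating_values_impossible\<close>). The sequence \<open>G\<^sub>0\<close> vanishes because \<open>\<Gamma>(m + 1)\<close> is an integer; the
  first sequence that does not vanish identically is a nonzero constant and has index at least 1, so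
  \<open>G\<^sub>n\<close> has at most \<open>n - 1\<close> zeros (\<open>card_zeros_le\<close>). Every algebraic \<open>\<Gamma>\<^sup>(\<^sup>n\<^sup>)(m + 1)\<close> gives such a zero.

  The transcendence of \<open>\<pi>\<close> is proved by Lindemann's method. Symmetric functions are handled through
  power sums: a finite family of complex numbers with rational power sums consists of algebraic
  numbers, and every algebraic number belongs to such a family. Logarithmic differentiation of
  products of power series makes both directions, as well as the passage to the family of all subset
  sums, a matter of comparing coefficients. If \<open>\<i>\<pi>\<close> belonged to such a family \<open>(\<alpha>\<^sub>i)\<close>, expanding
  \<open>\<Prod>\<^sub>i (1 + exp \<alpha>\<^sub>i) = 0\<close> would give a vanishing sum of exponentials of a family that has rational
  power sums and contains \<open>0\<close>. Hermite's construction excludes this (\<open>exp_sum_nonzero\<close>).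
\<close>

section \<open>Power series with coefficients in a subring\<close>

text \<open>
  Newton's identities are needed over both \<open>\<rat>\<close> and \<open>\<int>\<close>; the predicate lets one proof serve for both.
\<close>
definition subring_of_complex :: "complex set \<Rightarrow> bool" where
  "subring_of_complex R \<longleftrightarrow> 0 \<in> R \<and> 1 \<in> R \<and> (\<forall>x\<in>R. \<forall>y\<in>R. x - y \<in> R \<and> x * y \<in> R)"

lemma subring_Rats: "subring_of_complex \<rat>" and subring_Ints: "subring_of_complex \<int>"
  by (auto simp: subring_of_complex_def)

lemma subring_minus: "subring_of_complex R \<Longrightarrow> x \<in> R \<Longrightarrow> - x \<in> R"
  unfolding subring_of_complex_def by (metis diff_0)

lemma subring_add: "subring_of_complex R \<Longrightarrow> x \<in> R \<Longrightarrow> y \<in> R \<Longrightarrow> x + y \<in> R"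
  using subring_minus[of R y] unfolding subring_of_complex_def by (metis diff_minus_eq_add)

lemma subring_mult: "subring_of_complex R \<Longrightarrow> x \<in> R \<Longrightarrow> y \<in> R \<Longrightarrow> x * y \<in> R"
  unfolding subring_of_complex_def by blast

lemma subring_sum:
  assumes "subring_of_complex R" "\<And>i. i \<in> I \<Longrightarrow> f i \<in> R"
  shows "sum f I \<in> R"
  using assms(2)
proof (induction I rule: infinite_finite_induct)
  case (insert x F)
  then show ?case using subring_add[OF assms(1)] by auto
qed (use assms(1) in \<open>auto simp: subring_of_complex_def\<close>)

lemma subring_of_nat: "subring_of_complex R \<Longrightarrow> of_nat n \<in> R"
  by (induction n) (auto intro: subring_add simp: subring_of_complex_def[of R])

text \<open>
  The coefficients of \<open>h\<close> are obtained recursively from those of \<open>f\<close> and \<open>f h\<close>, and the only division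
  is by the constant term of \<open>f\<close>.
\<close>
lemma fps_factor_coeffs:
  assumes R: "subring_of_complex R" and u: "u \<in> R" "u * fps_nth f 0 = 1"
    and f: "\<And>n. fps_nth f n \<in> R" and fh: "\<And>n. fps_nth (f * h) n \<in> R"
  shows "fps_nth h n \<in> R"
proof (induction n rule: less_induct)
  case (less n)
  define s where "s = (\<Sum>i=1..n. fps_nth f i * fps_nth h (n - i))"
  have s: "s \<in> R" unfolding s_def
    by (intro subring_sum[OF R] subring_mult[OF R] f less) auto
  have "fps_nth (f * h) n = fps_nth f 0 * fps_nth h n + s"
    unfolding fps_mult_nth s_def by (subst sum.atLeast_Suc_atMost) auto
  hence "u * fps_nth (f * h) n = (u * fps_nth f 0) * fps_nth h n + u * s"
    by (simp add: algebra_simps)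
  hence "fps_nth h n = u * fps_nth (f * h) n + (- (u * s))"
    unfolding u(2) by simp
  moreover have "u * fps_nth (f * h) n + (- (u * s)) \<in> R"
    by (intro subring_add[OF R] subring_mult[OF R] subring_minus[OF R] s u fh)
  ultimately show ?case by simp
qed

text \<open>
  The equation \<open>P' = P G\<close> determines \<open>P\<close> from its constant term and \<open>G\<close>, by a recursion that divides
  only by positive integers.
\<close>
lemma fps_exponential_ode_rational:
  fixes P G :: "complex fps"
  assumes ode: "fps_deriv P = P * G" and P0: "fps_nth P 0 \<in> \<rat>" and G: "\<And>n. fps_nth G n \<in> \<rat>"
  shows "fps_nth P n \<in> \<rat>"
proof (induction n rule: less_induct)
  case (less n)
  show ?case
  proof (cases n)
    case (Suc k)
    have "of_nat (Suc k) * fps_nth P (Suc k) = fps_nth (P * G) k"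
      using arg_cong[OF ode, of "\<lambda>F. fps_nth F k"] by simp
    also have "\<dots> \<in> \<rat>"
      unfolding fps_mult_nth by (intro Rats_sum Rats_mult G less) (auto simp: Suc)
    finally have "inverse (of_nat (Suc k)) * (of_nat (Suc k) * fps_nth P (Suc k)) \<in> \<rat>"
      by (intro Rats_mult[of "inverse (of_nat (Suc k))"] Rats_inverse) auto
    moreover have "inverse (of_nat (Suc k)) * (of_nat (Suc k) * fps_nth P (Suc k)) = fps_nth P n"
      unfolding Suc by (subst mult.assoc[symmetric], subst left_inverse) (simp_all del: of_nat_Suc)
    ultimately show ?thesis by simp
  qed (use P0 in auto)
qed

lemma fps_deriv_prod_logarithmic:
  fixes g h :: "'i \<Rightarrow> complex fps"
  assumes "\<And>i. i \<in> I \<Longrightarrow> fps_deriv (g i) = g i * h i"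
  shows "fps_deriv (\<Prod>i\<in>I. g i) = (\<Prod>i\<in>I. g i) * (\<Sum>i\<in>I. h i)"
  using assms by (induction I rule: infinite_finite_induct) (auto simp: algebra_simps)

lemma fps_deriv_dilate:
  "fps_deriv (Abs_fps (\<lambda>n. a ^ n * fps_nth f n)) =
     fps_const (a :: complex) * Abs_fps (\<lambda>n. a ^ n * fps_nth (fps_deriv f) n)"
  by (simp add: fps_eq_iff)

lemma fps_dilate_mult:
  "Abs_fps (\<lambda>n. a ^ n * fps_nth (f * g) n) =
     Abs_fps (\<lambda>n. (a :: complex) ^ n * fps_nth f n) * Abs_fps (\<lambda>n. a ^ n * fps_nth g n)"
  by (simp add: fps_compose_linear[symmetric] fps_compose_mult_distrib)

lemma fps_nth_prod_0: "fps_nth (\<Prod>i\<in>I. g i) 0 = (\<Prod>i\<in>I. fps_nth (g i) 0 :: complex)"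
  by (induction I rule: infinite_finite_induct) auto

text \<open>
  The product \<open>P(t) = \<Prod>\<^sub>i f(a\<^sub>i t)\<close> is symmetric in the \<open>a\<^sub>i\<close>. With \<open>h = f'/f\<close> its logarithmic derivative
  is \<open>\<Sum>\<^sub>i a\<^sub>i h(a\<^sub>i t)\<close>, whose coefficients are those of \<open>h\<close> multiplied by power sums of the \<open>a\<^sub>i\<close>. The choice
  \<open>f = 1 - t\<close> recovers elementary symmetric functions from power sums, and \<open>f = exp t + 1\<close> yields the
  power sums of all subset sums.
\<close>
lemma rational_prod_of_dilates:
  fixes f :: "complex fps" and a :: "'i \<Rightarrow> complex"
  assumes f: "\<And>n. fps_nth f n \<in> \<rat>" "fps_nth f 0 \<noteq> 0"
    and p: "\<And>k. (\<Sum>i\<in>I. a i ^ k) \<in> \<rat>"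
  shows "fps_nth (\<Prod>i\<in>I. Abs_fps (\<lambda>n. a i ^ n * fps_nth f n)) n \<in> \<rat>"
proof -
  define D where "D = (\<lambda>f i. Abs_fps (\<lambda>n. a i ^ n * fps_nth f n))"
  define h where "h = fps_deriv f * inverse f"
  have fh: "f * h = fps_deriv f"
    unfolding h_def using f(2) by (metis inverse_mult_eq_1' mult.commute mult.left_commute mult.right_neutral)
  have h: "fps_nth h n \<in> \<rat>" for n
  proof (rule fps_factor_coeffs[OF subring_Rats, where f = f])
    show "inverse (fps_nth f 0) \<in> \<rat>" using f by auto
    show "inverse (fps_nth f 0) * fps_nth f 0 = 1" using f by simp
    show "fps_nth (f * h) n \<in> \<rat>" for n
      unfolding fh fps_deriv_nth using f by (intro Rats_mult) (auto simp del: of_nat_add of_nat_Suc)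
  qed (use f in auto)
  have "fps_deriv (\<Prod>i\<in>I. D f i) = (\<Prod>i\<in>I. D f i) * (\<Sum>i\<in>I. fps_const (a i) * D h i)"
  proof (rule fps_deriv_prod_logarithmic)
    show "fps_deriv (D f i) = D f i * (fps_const (a i) * D h i)" for i
      unfolding D_def fps_deriv_dilate
      by (subst fh[symmetric], subst fps_dilate_mult) (simp add: mult_ac)
  qed
  moreover have "fps_nth (\<Prod>i\<in>I. D f i) 0 \<in> \<rat>"
    unfolding fps_nth_prod_0 using f by (simp add: D_def)
  moreover have "fps_nth (\<Sum>i\<in>I. fps_const (a i) * D h i) n \<in> \<rat>" for n
  proof -
    have "fps_nth (\<Sum>i\<in>I. fps_const (a i) * D h i) n = (\<Sum>i\<in>I. a i ^ Suc n) * fps_nth h n"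
      by (simp add: fps_sum_nth D_def sum_distrib_right sum_distrib_left mult_ac)
    also have "\<dots> \<in> \<rat>" by (intro Rats_mult p h)
    finally show ?thesis .
  qed
  ultimately show ?thesis
    using fps_exponential_ode_rational unfolding D_def by blast
qed

section \<open>Families with rational power sums and algebraic numbers\<close>

text \<open>
  For \<open>q(t) = \<Prod>\<^sub>i (1 - a\<^sub>i t)\<close> the power sums are the coefficients of \<open>-q'/q\<close>. Since \<open>q\<close> has constant
  term 1, this quotient has coefficients in every ring that contains those of \<open>q\<close>.
\<close>
lemma power_sums_from_coeffs:
  fixes a :: "'i \<Rightarrow> complex"
  assumes R: "subring_of_complex R" 
    and c: "\<And>n. coeff (\<Prod>i\<in>I. [:1, - a i:]) n \<in> R"
  shows "(\<Sum>i\<in>I. a i ^ k) \<in> R"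
proof (cases k)
  case 0
  then show ?thesis using subring_of_nat[OF R] by simp
next
  case (Suc m)
  define q where "q = (\<Prod>i\<in>I. fps_of_poly [:1, - a i:])"
  define h where "h = (\<lambda>i. Abs_fps (\<lambda>n. - (a i ^ Suc n)))"
  have q: "q = fps_of_poly (\<Prod>i\<in>I. [:1, - a i:])"
    by (simp add: q_def fps_of_poly_prod)
  have q_coeff: "fps_nth q n \<in> R" for n
    using c by (simp add: q)
  have d: "fps_deriv q = q * (\<Sum>i\<in>I. h i)"
    unfolding q_def
  proof (rule fps_deriv_prod_logarithmic)
    fix i
    have "fps_nth (fps_deriv (fps_of_poly [:1, - a i:])) n = 
          fps_nth (fps_of_poly [:1, - a i:] * h i) n" for n
      unfolding fps_of_poly_linear' h_def
      by (cases n) (simp_all add: algebra_simps)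
    thus "fps_deriv (fps_of_poly [:1, - a i:]) = fps_of_poly [:1, - a i:] * h i"
      by (simp add: fps_eq_iff)
  qed
  have "fps_nth (\<Sum>i\<in>I. h i) m \<in> R"
  proof (rule fps_factor_coeffs[OF R, where f = q])
    show "1 * fps_nth q 0 = 1" unfolding q_def fps_nth_prod_0 by simp
    show "fps_nth (q * (\<Sum>i\<in>I. h i)) n \<in> R" for n
      unfolding d[symmetric] fps_deriv_nth
      by (intro subring_mult[OF R] subring_of_nat[OF R] q_coeff)
  qed (use R q_coeff in \<open>auto simp: subring_of_complex_def\<close>)
  hence "- fps_nth (\<Sum>i\<in>I. h i) m \<in> R" by (rule subring_minus[OF R])
  thus ?thesis by (simp add: fps_sum_nth h_def Suc sum_negf)
qed

lemma coeffs_from_power_sums: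
  fixes a :: "'i \<Rightarrow> complex"
  assumes p: "\<And>k. (\<Sum>i\<in>I. a i ^ k) \<in> \<rat>"
  shows "coeff (\<Prod>i\<in>I. [:1, - a i:]) n \<in> \<rat>"
proof -
  have "fps_of_poly [:1, - a i:] = Abs_fps (\<lambda>n. a i ^ n * fps_nth (1 - fps_X) n)" for i
    unfolding fps_eq_iff
  proof
    fix n show "fps_nth (fps_of_poly [:1, - a i:]) n = fps_nth (Abs_fps (\<lambda>n. a i ^ n * fps_nth (1 - fps_X) n)) n"
      by (cases n; cases "n - 1") (auto simp: coeff_pCons fps_of_poly_nth)
  qed
  hence "coeff (\<Prod>i\<in>I. [:1, - a i:]) n =
        fps_nth (\<Prod>i\<in>I. Abs_fps (\<lambda>n. a i ^ n * fps_nth (1 - fps_X) n)) n"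
    by (metis (no_types, lifting) fps_of_poly_nth fps_of_poly_prod prod.cong)
  also have "\<dots> \<in> \<rat>"
    by (intro rational_prod_of_dilates p) auto
  finally show ?thesis .
qed

lemma reversed_linear_factors:
  assumes "finite I"
  shows "(\<Prod>i\<in>I. [:1, - a i:]) = reflect_poly (\<Prod>i\<in>I. [:- a i, 1 :: complex:])"
    and "degree (\<Prod>i\<in>I. [:- a i, 1 :: complex:]) = card I"
proof -
  have "reflect_poly [:- x, 1:] = [:1, - x :: complex:]" for x
    by (cases "x = 0") (auto simp: reflect_poly_def cCons_def)
  thus "(\<Prod>i\<in>I. [:1, - a i:]) = reflect_poly (\<Prod>i\<in>I. [:- a i, 1 :: complex:])"
    by (simp add: reflect_poly_prod)
  show "degree (\<Prod>i\<in>I. [:- a i, 1 :: complex:]) = card I"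
    by (subst degree_prod_eq_sum_degree) auto
qed

text \<open>
  The polynomials \<open>\<Prod>\<^sub>i (1 - a\<^sub>i t)\<close> and \<open>\<Prod>\<^sub>i (t - a\<^sub>i)\<close> have the same coefficients in opposite order. This
  stays true when some \<open>a\<^sub>i\<close> vanish, except for zero coefficients at the top of the former.
\<close>
lemma reversed_linear_factors_coeffs_iff:
  assumes "finite I" "0 \<in> R"
  shows "(\<forall>n. coeff (\<Prod>i\<in>I. [:1, - a i:]) n \<in> R) \<longleftrightarrow>
         (\<forall>n. coeff (\<Prod>i\<in>I. [:- a i, 1 :: complex:]) n \<in> R)"
proof -
  define P where "P = (\<Prod>i\<in>I. [:- a i, 1 :: complex:])"
  have "(\<forall>n. coeff (reflect_poly P) n \<in> R) \<longleftrightarrow> (\<forall>n. coeff P n \<in> R)"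
  proof (intro iffI allI)
    fix n assume "\<forall>n. coeff P n \<in> R"
    thus "coeff (reflect_poly P) n \<in> R" using assms by (auto simp: coeff_reflect_poly)
  next
    fix n assume *: "\<forall>n. coeff (reflect_poly P) n \<in> R"
    show "coeff P n \<in> R"
    proof (cases "n \<le> degree P")
      case True
      hence "coeff P n = coeff (reflect_poly P) (degree P - n)" by (simp add: coeff_reflect_poly)
      thus ?thesis using * by simp
    qed (use assms in \<open>auto simp: coeff_eq_0\<close>)
  qed
  thus ?thesis using reversed_linear_factors(1)[OF assms(1)] by (simp add: P_def)
qed

lemma algebraic_if_rational_power_sums:
  fixes a :: "'i \<Rightarrow> complex"
  assumes I: "finite I" "i \<in> I" and p: "\<And>k. (\<Sum>i\<in>I. a i ^ k) \<in> \<rat>"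
  shows "algebraic (a i)"
proof (rule algebraicI')
  show "coeff (\<Prod>i\<in>I. [:- a i, 1:]) n \<in> \<rat>" for n
    using reversed_linear_factors_coeffs_iff[OF I(1), of \<rat> a] coeffs_from_power_sums[OF p] by auto
  show "(\<Prod>i\<in>I. [:- a i, 1:]) \<noteq> 0" using I by auto
  show "poly (\<Prod>i\<in>I. [:- a i, 1:]) (a i) = 0" using I by (auto simp: poly_prod)
qed

lemma algebraic_imp_rational_power_sums:
  assumes "algebraic (x :: complex)"
  obtains I :: "nat set" and a where "finite I" "x \<in> a ` I" "\<And>k. (\<Sum>i\<in>I. a i ^ k) \<in> \<rat>"
proof -
  obtain P where P: "\<And>i. coeff P i \<in> \<rat>" "P \<noteq> 0" "poly P x = 0"
    using assms unfolding algebraic_altdef by auto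
  obtain A where A: "P = smult (lead_coeff P) (\<Prod>x\<in>#A. [:-x, 1:])"
    using alg_closed_imp_factorization[of P] P(2) by blast
  obtain xs where xs: "mset xs = A" using ex_mset by blast
  define I where "I = {0..<length xs}"
  define Q where "Q = (\<Prod>i\<in>I. [:- (xs ! i), 1:])"
  have "(\<Prod>x\<in>#A. [:-x, 1:]) = prod_list (map (\<lambda>x. [:-x, 1:]) xs)"
    unfolding xs[symmetric] by (metis mset_map prod_mset_prod_list)
  also have "\<dots> = Q" unfolding Q_def I_def
    by (subst prod.list_conv_set_nth) simp
  finally have PQ: "P = smult (lead_coeff P) Q" using A by simp
  have "coeff Q n \<in> \<rat>" for n
  proof -
    have "coeff P n = lead_coeff P * coeff Q n"
      by (subst PQ) simp
    hence "coeff Q n = coeff P n / lead_coeff P"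
      using P(2) by simp
    thus ?thesis using P(1) by auto
  qed
  hence *: "coeff (\<Prod>i\<in>I. [:1, - (xs ! i):]) n \<in> \<rat>" for n
    using reversed_linear_factors_coeffs_iff[of I \<rat> "(!) xs"] unfolding Q_def I_def by auto
  show ?thesis
  proof (rule that[of I "(!) xs"])
    show "finite I" by (simp add: I_def)
    show "(\<Sum>i\<in>I. xs ! i ^ k) \<in> \<rat>" for k
      by (rule power_sums_from_coeffs[OF subring_Rats *])
    have "poly Q x = 0" using P(2,3) PQ by (metis leading_coeff_0_iff mult_eq_0_iff poly_smult)
    thus "x \<in> (!) xs ` I" by (auto simp: Q_def poly_prod I_def)
  qed
qed

text \<open>
  The family of all sums \<open>a\<^sub>i + b\<^sub>j\<close> of two families with rational power sums again has rational power
  sums, by the binomial theorem.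
\<close>
lemma algebraic_add:
  assumes "algebraic (x :: complex)" "algebraic y"
  shows "algebraic (x + y)"
proof -
  obtain I :: "nat set" and a where a: "finite I" "x \<in> a ` I" "\<And>k. (\<Sum>i\<in>I. a i ^ k) \<in> \<rat>"
    using algebraic_imp_rational_power_sums[OF assms(1)] by metis
  obtain J :: "nat set" and b where b: "finite J" "y \<in> b ` J" "\<And>k. (\<Sum>i\<in>J. b i ^ k) \<in> \<rat>"
    using algebraic_imp_rational_power_sums[OF assms(2)] by metis
  from a b obtain i j where ij: "i \<in> I" "j \<in> J" "x = a i" "y = b j" by blast
  have "algebraic ((\<lambda>(i, j). a i + b j) (i, j))"
  proof (rule algebraic_if_rational_power_sums[where a = "\<lambda>(i, j). a i + b j"])
    show "finite (I \<times> J)" "(i, j) \<in> I \<times> J" using a b ij by auto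
    fix k
    have "(\<Sum>z\<in>I \<times> J. (\<lambda>(i, j). a i + b j) z ^ k) = (\<Sum>i\<in>I. \<Sum>j\<in>J. (a i + b j) ^ k)"
      by (subst sum.cartesian_product) (simp add: case_prod_unfold)
    also have "\<dots> = (\<Sum>l\<le>k. of_nat (k choose l) * (\<Sum>i\<in>I. a i ^ l) * (\<Sum>j\<in>J. b j ^ (k - l)))"
      unfolding binomial_ring sum_distrib_left sum_distrib_right
      by (subst sum.swap, subst (2) sum.swap, subst sum.swap) (simp add: mult_ac)
    also have "\<dots> \<in> \<rat>" by (intro Rats_sum Rats_mult a b) auto
    finally show "(\<Sum>z\<in>I \<times> J. (\<lambda>(i, j). a i + b j) z ^ k) \<in> \<rat>" .
  qed
  thus ?thesis by (simp add: ij)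
qed

lemma algebraic_mult:
  assumes "algebraic (x :: complex)" "algebraic y"
  shows "algebraic (x * y)"
proof -
  obtain I :: "nat set" and a where a: "finite I" "x \<in> a ` I" "\<And>k. (\<Sum>i\<in>I. a i ^ k) \<in> \<rat>"
    using algebraic_imp_rational_power_sums[OF assms(1)] by metis
  obtain J :: "nat set" and b where b: "finite J" "y \<in> b ` J" "\<And>k. (\<Sum>i\<in>J. b i ^ k) \<in> \<rat>"
    using algebraic_imp_rational_power_sums[OF assms(2)] by metis
  from a b obtain i j where ij: "i \<in> I" "j \<in> J" "x = a i" "y = b j" by blast
  have "algebraic ((\<lambda>(i, j). a i * b j) (i, j))"
  proof (rule algebraic_if_rational_power_sums[where a = "\<lambda>(i, j). a i * b j"])
    show "finite (I \<times> J)" "(i, j) \<in> I \<times> J" using a b ij by auto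
    fix k
    have "(\<Sum>z\<in>I \<times> J. (\<lambda>(i, j). a i * b j) z ^ k) = (\<Sum>i\<in>I. a i ^ k) * (\<Sum>j\<in>J. b j ^ k)"
      by (simp add: case_prod_unfold sum_product sum.cartesian_product power_mult_distrib)
    also have "\<dots> \<in> \<rat>" by (intro Rats_mult a b)
    finally show "(\<Sum>z\<in>I \<times> J. (\<lambda>(i, j). a i * b j) z ^ k) \<in> \<rat>" .
  qed
  thus ?thesis by (simp add: ij)
qed

lemma fact_in_Rats: "(fact n :: complex) \<in> \<rat>"
  by (metis of_nat_fact Rats_of_nat)

text \<open>
  The exponential generating function of these power sums is \<open>\<Sum>\<^sub>S exp (t \<Sum>\<^sub>i\<^sub>\<in>\<^sub>S a\<^sub>i) = \<Prod>\<^sub>i (exp (a\<^sub>i t) + 1)\<close>,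
  a product of dilates of one rational power series.
\<close>
lemma subset_sums_rational_power_sums:
  fixes a :: "'i \<Rightarrow> complex"
  assumes I: "finite I" and p: "\<And>k. (\<Sum>i\<in>I. a i ^ k) \<in> \<rat>"
  shows "(\<Sum>S\<in>Pow I. (\<Sum>i\<in>S. a i) ^ k) \<in> \<rat>"
proof -
  have exp_sum: "fps_exp (\<Sum>i\<in>S. a i) = (\<Prod>i\<in>S. fps_exp (a i))" for S
    by (induction S rule: infinite_finite_induct) (auto simp: fps_exp_add_mult)
  have "(\<Sum>S\<in>Pow I. fps_exp (\<Sum>i\<in>S. a i)) = (\<Prod>i\<in>I. fps_exp (a i) + 1)"
    unfolding exp_sum by (subst prod_add[OF I]) simp
  also have "\<dots> = (\<Prod>i\<in>I. Abs_fps (\<lambda>n. a i ^ n * fps_nth (fps_exp 1 + 1) n))"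
    by (intro prod.cong) (auto simp: fps_eq_iff)
  also have "fps_nth \<dots> k \<in> \<rat>"
  proof (rule rational_prod_of_dilates[OF _ _ p])
    show "fps_nth (fps_exp 1 + 1 :: complex fps) n \<in> \<rat>" for n
      unfolding fps_add_nth fps_exp_nth fps_one_nth power_one
      by (intro Rats_add Rats_divide) (auto simp: fact_in_Rats)
  qed auto
  finally have "fps_nth (\<Sum>S\<in>Pow I. fps_exp (\<Sum>i\<in>S. a i)) k \<in> \<rat>" .
  hence "fact k * fps_nth (\<Sum>S\<in>Pow I. fps_exp (\<Sum>i\<in>S. a i)) k \<in> \<rat>"
    by (intro Rats_mult) (simp_all only: fact_in_Rats)
  thus ?thesis by (simp add: fps_sum_nth sum_distrib_left)
qed

section \<open>Hermite's construction\<close>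

lemma common_denominator:
  fixes x :: "nat \<Rightarrow> complex"
  assumes "\<And>n. n < d \<Longrightarrow> x n \<in> \<rat>"
  shows "\<exists>c::nat. c > 0 \<and> (\<forall>n<d. of_nat c * x n \<in> \<int>)"
  using assms
proof (induction d)
  case (Suc d)
  then obtain c :: nat where c: "c > 0" "\<And>n. n < d \<Longrightarrow> of_nat c * x n \<in> \<int>"
    by auto
  obtain u v where uv: "v > 0" "x d = of_int u / of_int v"
    using Suc.prems[of d] by (auto elim: Rats_cases')
  have "of_nat (c * nat v) * x n \<in> \<int>" if "n < Suc d" for n
  proof (cases "n = d")
    case True
    have "of_nat (nat v) * x d = of_int u"
      using uv by (simp add: of_nat_nat)
    hence "of_nat (c * nat v) * x n = of_nat c * of_int u"
      using True by (simp add: mult.assoc)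
    thus ?thesis by (metis Ints_mult Ints_of_nat Ints_of_int)
  next
    case False
    hence "of_nat (nat v) * (of_nat c * x n) \<in> \<int>"
      using that by (intro Ints_mult c) auto
    thus ?thesis by (simp add: mult_ac)
  qed
  moreover have "c * nat v > 0" using c uv by simp
  ultimately show ?case by blast
qed (auto intro: exI[of _ 1])

text \<open>
  Scaling the family by \<open>c\<close> multiplies the coefficient of \<open>t\<^sup>n\<close> by \<open>c\<^sup>n\<close>. The constant term is already
  1, so a common denominator of the other coefficients suffices for \<open>c\<close>.
\<close>
lemma scaled_family_integral:
  fixes \<beta> :: "'i \<Rightarrow> complex"
  assumes "\<And>k. (\<Sum>j\<in>J. \<beta> j ^ k) \<in> \<rat>"
  obtains c :: nat where "c > 0" "\<And>n. coeff (\<Prod>j\<in>J. [:1, - (of_nat c * \<beta> j):]) n \<in> \<int>"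
proof -
  define q where "q = (\<Prod>j\<in>J. [:1, - \<beta> j:])"
  obtain c :: nat where c: "c > 0" "\<And>n. n < Suc (degree q) \<Longrightarrow> of_nat c * coeff q n \<in> \<int>"
    using common_denominator[of "Suc (degree q)" "coeff q"] coeffs_from_power_sums[OF assms]
    unfolding q_def by auto
  have q0: "coeff q 0 = 1"
    unfolding q_def poly_0_coeff_0[symmetric] poly_prod by simp
  have "coeff (\<Prod>j\<in>J. [:1, - (of_nat c * \<beta> j):]) n \<in> \<int>" for n
  proof -
    have "(\<Prod>j\<in>J. [:1, - (of_nat c * \<beta> j):]) = pcompose q [:0, of_nat c:]"
      unfolding q_def pcompose_prod by (simp add: pcompose_pCons mult_ac)
    hence eq: "coeff (\<Prod>j\<in>J. [:1, - (of_nat c * \<beta> j):]) n = of_nat c ^ n * coeff q n"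
      by (simp add: coeff_pcompose_linear)
    show ?thesis
    proof (cases "n = 0 \<or> n > degree q")
      case True
      thus ?thesis unfolding eq using q0 by (auto simp: coeff_eq_0)
    next
      case False
      then obtain m where "n = Suc m" by (cases n) auto
      hence "of_nat c ^ n * coeff q n = of_nat c ^ m * (of_nat c * coeff q n)" by simp
      also have "\<dots> \<in> \<int>" using False by (intro Ints_mult c) auto
      finally show ?thesis unfolding eq .
    qed
  qed
  thus ?thesis using that c by blast
qed

text \<open>
  This is \<open>F = f + f' + f'' + \<dots>\<close> for the polynomial \<open>f(x) = H(c x)\<close>. The scaling is kept apart from \<open>H\<close>
  so that \<open>H\<close> can have integer coefficients and be evaluated at algebraic integers \<open>c x\<close>.
\<close>
definition hermite_sum :: "complex poly \<Rightarrow> complex \<Rightarrow> complex \<Rightarrow> complex" where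
  "hermite_sum H c x = (\<Sum>i\<le>degree H. c ^ i * poly ((pderiv ^^ i) H) (c * x))"

lemma higher_pderiv_gt_degree: "degree (H :: complex poly) < i \<Longrightarrow> (pderiv ^^ i) H = 0"
  by (simp add: poly_eq_iff coeff_higher_pderiv coeff_eq_0)

lemma hermite_sum_deriv:
  "(hermite_sum H c has_field_derivative hermite_sum H c x - poly H (c * x)) (at x)"
proof -
  have "(hermite_sum H c has_field_derivative 
          (\<Sum>i\<le>degree H. c ^ i * (poly (pderiv ((pderiv ^^ i) H)) (c * x) * c))) (at x)"
    unfolding hermite_sum_def
    by (rule derivative_eq_intros DERIV_chain2[OF poly_DERIV] refl | simp add: mult_ac)+
  also have "(\<Sum>i\<le>degree H. c ^ i * (poly (pderiv ((pderiv ^^ i) H)) (c * x) * c)) =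
             (\<Sum>i\<le>degree H. c ^ Suc i * poly ((pderiv ^^ Suc i) H) (c * x))"
    by (simp add: mult_ac)
  also have "\<dots> = hermite_sum H c x - poly H (c * x)"
    using sum.atMost_Suc_shift[of "\<lambda>i. c ^ i * poly ((pderiv ^^ i) H) (c * x)" "degree H"]
    by (simp add: hermite_sum_def higher_pderiv_gt_degree[of H "Suc (degree H)", simplified])
  finally show ?thesis .
qed

text \<open>
  Since \<open>F' = F - f\<close>, the function \<open>exp (-x) F(x)\<close> has derivative \<open>-exp (-x) f(x)\<close>, and the mean value
  inequality compares its values at \<open>x\<close> and at \<open>0\<close>.
\<close>
lemma hermite_sum_exp_approx:
  assumes B: "\<And>z. norm z \<le> r \<Longrightarrow> norm (poly H (c * z)) \<le> B" and x: "norm x \<le> r"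
  shows "norm (hermite_sum H c x - exp x * hermite_sum H c 0) \<le> exp r * (exp r * B * r)"
proof -
  have r: "r \<ge> 0" using x norm_ge_zero order_trans by blast
  have B0: "B \<ge> 0" using B[OF x] norm_ge_zero order_trans by blast
  define E where "E = (\<lambda>z. exp (- z) * hermite_sum H c z)"
  have "norm (E x - E 0) \<le> exp r * B * norm (x - 0)"
  proof (rule field_differentiable_bound[where S = "cball 0 r" and f' = "\<lambda>z. - (exp (- z) * poly H (c * z))"])
    fix z :: complex assume z: "z \<in> cball 0 r"
    have "(E has_field_derivative - (exp (- z) * poly H (c * z))) (at z)"
      unfolding E_def
      by (rule derivative_eq_intros hermite_sum_deriv refl | simp add: algebra_simps)+
    thus "(E has_field_derivative - (exp (- z) * poly H (c * z))) (at z within cball 0 r)"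
      by (rule has_field_derivative_at_within)
    have "norm (exp (- z)) \<le> exp (norm (- z))" by (rule norm_exp)
    also have "\<dots> \<le> exp r" using z by simp
    finally show "norm (- (exp (- z) * poly H (c * z))) \<le> exp r * B"
      using z B0 unfolding norm_minus_cancel norm_mult by (intro mult_mono B) auto
  qed (use x r in auto)
  also have "\<dots> \<le> exp r * B * r" using x B0 by (intro mult_left_mono) auto
  finally have E: "norm (E x - E 0) \<le> exp r * B * r" .
  have "norm (exp x) \<le> exp (norm x)" by (rule norm_exp)
  also have "\<dots> \<le> exp r" using x by simp
  finally have ex: "norm (exp x) \<le> exp r" .
  have "hermite_sum H c x - exp x * hermite_sum H c 0 = exp x * (E x - E 0)"
    by (simp add: E_def algebra_simps flip: exp_add mult.assoc)
  thus ?thesis using ex E r B0 by (auto simp: norm_mult intro!: mult_mono)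
qed

lemma higher_pderiv_root:
  assumes "[:- a, 1:] ^ n dvd P" "i < n"
  shows "poly ((pderiv ^^ i) P) (a :: complex) = 0"
  using assms
proof (induction i arbitrary: P n)
  case 0
  hence "[:- a, 1:] dvd P" by (metis dvd_power dvd_trans gr0I less_nat_zero_code)
  thus ?case by (simp add: poly_eq_0_iff_dvd)
next
  case (Suc i)
  then obtain m where m: "n = Suc m" by (cases n) auto
  define l where "l = [:- a, 1:]"
  obtain Q where Q: "P = l ^ Suc m * Q" using Suc.prems(1) unfolding m l_def by (elim dvdE)
  have "l ^ m dvd l ^ Suc m * pderiv Q + Q * (smult (of_nat (Suc m)) (l ^ m) * pderiv l)"
    by (intro dvd_add dvd_mult[of _ _ Q] dvd_mult2 dvd_smult dvd_refl le_imp_power_dvd) simp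
  hence "[:- a, 1:] ^ m dvd pderiv P"
    unfolding Q pderiv_mult pderiv_power_Suc l_def .
  thus ?case using Suc.IH[of m "pderiv P"] Suc.prems m by (simp add: funpow_Suc_right del: funpow.simps)
qed

lemma higher_pderiv_coeff_binomial:
  "coeff ((pderiv ^^ i) H) n = fact i * (of_nat ((n + i) choose i) * coeff (H :: complex poly) (n + i))"
proof -
  have "fact n * pochhammer (of_nat (Suc n)) i = (fact (n + i) :: complex)"
    using pochhammer_product[of n "n + i" "1 :: complex"]
    by (simp add: pochhammer_fact add.commute)
  moreover have "(fact (n + i) :: complex) = fact i * fact n * of_nat ((n + i) choose i)"
    using arg_cong[OF binomial_fact_lemma[of i "n + i"], of "of_nat :: nat \<Rightarrow> complex"]
    by (simp add: mult_ac)
  ultimately have "fact n * (pochhammer (of_nat (Suc n)) i - fact i * of_nat ((n + i) choose i)) = (0 :: complex)"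
    by (simp add: algebra_simps)
  hence "pochhammer (of_nat (Suc n)) i = (fact i * of_nat ((n + i) choose i) :: complex)"
    by simp
  thus ?thesis unfolding coeff_higher_pderiv by (simp add: mult_ac)
qed

lemma sum_poly_integral:
  assumes "\<And>n. coeff P n \<in> \<int>" "\<And>k. (\<Sum>j\<in>J. b j ^ k) \<in> \<int>"
  shows "(\<Sum>j\<in>J. poly P (b j :: complex)) \<in> \<int>"
proof -
  have "(\<Sum>j\<in>J. poly P (b j)) = (\<Sum>n\<le>degree P. coeff P n * (\<Sum>j\<in>J. b j ^ n))"
    unfolding poly_altdef sum_distrib_left by (rule sum.swap)
  also have "\<dots> \<in> \<int>" by (intro Ints_sum Ints_mult assms)
  finally show ?thesis .
qed

text \<open>
  The coefficients of the \<open>i\<close>-th derivative of an integer polynomial are divisible by \<open>i!\<close>, the quotients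
  being binomial multiples of the original coefficients. Summing over the whole family turns the values
  into integer combinations of power sums.
\<close>
lemma sum_higher_pderiv_divisible:
  assumes "\<And>n. coeff H n \<in> \<int>" "\<And>k. (\<Sum>j\<in>J. b j ^ k) \<in> \<int>"
  shows "\<exists>N\<in>\<int>. (\<Sum>j\<in>J. poly ((pderiv ^^ i) H) (b j :: complex)) = fact i * N"
proof -
  define P where "P = smult (inverse (fact i)) ((pderiv ^^ i) H)"
  have eq: "(pderiv ^^ i) H = smult (fact i) P" by (simp add: P_def)
  have "coeff P n \<in> \<int>" for n
    unfolding P_def coeff_smult higher_pderiv_coeff_binomial mult.assoc[symmetric]
    using Ints_mult[OF Ints_of_nat assms(1)[of "n + i"], of "(n + i) choose i"] by simp
  hence "(\<Sum>j\<in>J. poly P (b j)) \<in> \<int>" by (rule sum_poly_integral[OF _ assms(2)])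
  thus ?thesis unfolding eq by (intro bexI) (simp add: sum_distrib_left[symmetric])
qed

lemma coeff_mult_closed:
  assumes "\<And>n. coeff P n \<in> \<int>" "\<And>n. coeff Q n \<in> \<int>"
  shows "coeff (P * Q) n \<in> (\<int> :: complex set)"
  unfolding coeff_mult by (intro Ints_sum Ints_mult assms)

lemma coeff_power_closed:
  assumes "\<And>n. coeff P n \<in> \<int>"
  shows "coeff (P ^ k) n \<in> (\<int> :: complex set)"
proof (induction k arbitrary: n)
  case 0
  then show ?case by (simp add: coeff_1)
next
  case (Suc k)
  then show ?case using coeff_mult_closed[OF assms] by simp
qed

text \<open>
  With \<open>H = x\<^sup>m \<theta>\<^sup>m\<^sup>+\<^sup>1\<close> all derivatives of order less than \<open>m\<close> vanish at every member of the family, and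
  the derivative of order \<open>m\<close> survives only at the members equal to \<open>0\<close>. Derivatives of higher order
  contribute multiples of \<open>(m + 1)!\<close>. So the sum is \<open>m!\<close> times an integer whose residue modulo \<open>m + 1\<close>
  is known.
\<close>
lemma hermite_sum_arithmetic:
  fixes b :: "'i \<Rightarrow> complex" and m c :: nat
  assumes J: "finite J" and ints: "\<And>k. (\<Sum>j\<in>J. b j ^ k) \<in> \<int>"
    and \<theta>: "\<theta> = (\<Prod>j | j \<in> J \<and> b j \<noteq> 0. [:- b j, 1:])" "\<And>n. coeff \<theta> n \<in> \<int>"
    and H: "H = monom 1 m * \<theta> ^ Suc m" and c: "c > 0"
  shows "\<exists>N\<in>\<int>. (\<Sum>j\<in>J. hermite_sum H (of_nat c) (b j / of_nat c)) =
     fact m * (of_nat (c ^ m * card {j\<in>J. b j = 0}) * poly \<theta> 0 ^ Suc m + of_nat (Suc m) * N)"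
proof -
  define k where "k = card {j\<in>J. b j = 0}"
  have Hint: "coeff H n \<in> \<int>" for n
    unfolding H by (intro coeff_mult_closed coeff_power_closed \<theta>) (auto simp: coeff_monom)
  have nz: "poly ((pderiv ^^ i) H) (b j) = 0" if "i \<le> m" "j \<in> J" "b j \<noteq> 0" for i j
  proof (rule higher_pderiv_root)
    have "[:- b j, 1:] dvd \<theta>" unfolding \<theta> using J that by (intro dvd_prodI) auto
    thus "[:- b j, 1:] ^ Suc m dvd H" unfolding H by (intro dvd_mult dvd_power_same)
  qed (use that in auto)
  have z: "poly ((pderiv ^^ i) H) 0 = (if i = m then fact m * poly \<theta> 0 ^ Suc m else 0)" if "i \<le> m" for i
    using that unfolding poly_0_coeff_0 higher_pderiv_coeff_binomial H coeff_monom_mult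
    by (auto simp: coeff_0_power simp del: power_Suc)
  have low: "(\<Sum>j\<in>J. poly ((pderiv ^^ i) H) (b j)) = (if i = m then fact m * (of_nat k * poly \<theta> 0 ^ Suc m) else 0)"
    if "i \<le> m" for i
  proof -
    have "(\<Sum>j\<in>J. poly ((pderiv ^^ i) H) (b j)) = (\<Sum>j | j \<in> J \<and> b j = 0. poly ((pderiv ^^ i) H) (b j))"
      using J nz[OF that] by (intro sum.mono_neutral_right) auto
    also have "\<dots> = of_nat k * poly ((pderiv ^^ i) H) 0" by (simp add: k_def)
    finally show ?thesis using z[OF that] by simp
  qed
  have "\<exists>N\<in>\<int>. (\<Sum>j\<in>J. poly ((pderiv ^^ i) H) (b j)) =
      fact m * ((if i = m then of_nat k * poly \<theta> 0 ^ Suc m else 0) + of_nat (Suc m) * N)" for i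
  proof (cases "i \<le> m")
    case True
    thus ?thesis using low by (intro bexI[of _ 0]) auto
  next
    case False
    obtain N where N: "N \<in> \<int>" "(\<Sum>j\<in>J. poly ((pderiv ^^ i) H) (b j)) = fact i * N"
      using sum_higher_pderiv_divisible[OF Hint ints] by blast
    have "fact (Suc m) dvd (fact i :: nat)" using False by (intro fact_dvd) auto
    then obtain l :: nat where "fact i = fact (Suc m) * l" by (elim dvdE)
    hence "(fact i :: complex) = fact (Suc m) * of_nat l" by (metis of_nat_fact of_nat_mult)
    thus ?thesis using N False by (intro bexI[of _ "of_nat l * N"]) (auto intro: Ints_mult)
  qed
  then obtain N where N: "\<And>i. N i \<in> \<int>" "\<And>i. (\<Sum>j\<in>J. poly ((pderiv ^^ i) H) (b j)) =
      fact m * ((if i = m then of_nat k * poly \<theta> 0 ^ Suc m else 0) + of_nat (Suc m) * N i)" by metis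
  have "H \<noteq> 0" using J by (simp add: H \<theta>)
  hence "m \<le> degree H"
    unfolding H by (subst degree_mult_eq) (auto simp: degree_monom_eq)
  have "(\<Sum>j\<in>J. hermite_sum H (of_nat c) (b j / of_nat c)) =
        (\<Sum>i\<le>degree H. of_nat c ^ i * (\<Sum>j\<in>J. poly ((pderiv ^^ i) H) (b j)))"
    using c unfolding hermite_sum_def sum_distrib_left by (subst sum.swap) simp
  also have "\<dots> = (\<Sum>i\<le>degree H. (if i = m then fact m * (of_nat (c ^ m * k) * poly \<theta> 0 ^ Suc m) else 0)
                     + fact m * of_nat (Suc m) * (of_nat c ^ i * N i))"
    unfolding N by (intro sum.cong) (auto simp: algebra_simps)
  also have "\<dots> = fact m * (of_nat (c ^ m * k) * poly \<theta> 0 ^ Suc m + of_nat (Suc m) * (\<Sum>i\<le>degree H. of_nat c ^ i * N i))"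
    using \<open>m \<le> degree H\<close>
    by (simp only: sum.distrib sum_distrib_left[symmetric] sum.delta) (simp add: algebra_simps)
  finally show ?thesis unfolding k_def by (intro bexI) (auto intro!: Ints_sum Ints_mult N)
qed

text \<open>
  If the exponentials summed to \<open>0\<close>, then \<open>\<Sum>\<^sub>j F(\<beta>\<^sub>j) = \<Sum>\<^sub>j (F(\<beta>\<^sub>j) - exp \<beta>\<^sub>j F(0))\<close>. The right-hand side grows
  at most like a geometric sequence in \<open>m\<close>. The left-hand side is \<open>m!\<close> times an integer, which is
  nonzero when \<open>m + 1\<close> is coprime to the scaling factor \<open>c\<close>, to the number of members equal to \<open>0\<close> and
  to \<open>\<theta>(0)\<close>. There are infinitely many such \<open>m\<close>.
\<close>
lemma exp_sum_nonzero:
  fixes \<beta> :: "'i \<Rightarrow> complex"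
  assumes J: "finite J" and p: "\<And>k. (\<Sum>j\<in>J. \<beta> j ^ k) \<in> \<rat>" and j0: "j0 \<in> J" "\<beta> j0 = 0"
  shows "(\<Sum>j\<in>J. exp (\<beta> j)) \<noteq> 0"
proof
  assume exp0: "(\<Sum>j\<in>J. exp (\<beta> j)) = 0"
  obtain c :: nat where c: "c > 0" "\<And>n. coeff (\<Prod>j\<in>J. [:1, - (of_nat c * \<beta> j):]) n \<in> \<int>"
    using scaled_family_integral[OF p] by blast
  define b where "b = (\<lambda>j. of_nat c * \<beta> j)"
  have b\<beta>: "b j / of_nat c = \<beta> j" for j using c by (simp add: b_def)
  define J' where "J' = {j \<in> J. b j \<noteq> 0}"
  define \<theta> where "\<theta> = (\<Prod>j\<in>J'. [:- b j, 1:])"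
  have ints: "(\<Sum>j\<in>J. b j ^ k) \<in> \<int>" for k
    using c(2) by (intro power_sums_from_coeffs[OF subring_Ints]) (simp add: b_def)
  \<comment> \<open>Members equal to \<open>0\<close> contribute the factor 1 to the reversed product.\<close>
  have "(\<Prod>j\<in>J'. [:1, - b j:]) = (\<Prod>j\<in>J. [:1, - b j:])"
    unfolding J'_def using J by (intro prod.mono_neutral_left) (auto simp: one_pCons)
  hence \<theta>_int: "coeff \<theta> n \<in> \<int>" for n
    using reversed_linear_factors_coeffs_iff[of J' \<int> b] c(2) J unfolding \<theta>_def J'_def b_def by simp
  obtain t where t: "poly \<theta> 0 = of_int t"
    using \<theta>_int[of 0] by (auto simp: poly_0_coeff_0 elim: Ints_cases)
  have "poly \<theta> 0 \<noteq> 0" using J by (simp add: \<theta>_def J'_def poly_prod)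
  hence t0: "t \<noteq> 0" using t by auto
  define k where "k = card {j \<in> J. b j = 0}"
  have "k > 0" unfolding k_def using J j0 by (subst card_gt_0_iff) (auto simp: b_def)
  \<comment> \<open>The parameter \<open>m\<close> will be a multiple of \<open>D\<close>, which makes the modulus \<open>m + 1\<close> coprime to \<open>D\<close>.\<close>
  define D where "D = int c * int k * t"
  have "D \<noteq> 0" using c t0 \<open>k > 0\<close> by (simp add: D_def)

  define r where "r = Max ((\<lambda>j. norm (\<beta> j)) ` J)"
  have r: "norm (\<beta> j) \<le> r" if "j \<in> J" for j
    unfolding r_def using J that by (intro Max_ge) auto
  have r0: "r \<ge> 0" using r[OF j0(1)] j0(2) by simp
  have "compact ((\<lambda>z. poly \<theta> (of_nat c * z)) ` cball 0 r)"
    by (intro compact_continuous_image continuous_intros) auto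
  from compact_imp_bounded[OF this] obtain L where
    L: "L > 0" "\<And>z. norm z \<le> r \<Longrightarrow> norm (poly \<theta> (of_nat c * z)) \<le> L"
    unfolding bounded_pos ball_simps by (auto simp del: of_nat_power)
  define K where "K = real c * r"
  define A where "A = real (card J) * (exp r * (exp r * L * r))"

  have bound: "fact m \<le> A * (K * L) ^ m" if m: "m = nat \<bar>D\<bar> * s" "s > 0" for m s
  proof -
    define H where "H = monom 1 m * \<theta> ^ Suc m"
    define T where "T = (\<Sum>j\<in>J. hermite_sum H (of_nat c) (\<beta> j))"
    obtain N where N: "T = fact m * (of_nat (c ^ m * k) * poly \<theta> 0 ^ Suc m + of_nat (Suc m) * of_int N)"
      using hermite_sum_arithmetic[OF J ints _ \<theta>_int H_def c(1)] 
      unfolding b\<beta> T_def k_def \<theta>_def J'_def by (auto elim!: Ints_cases)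
    define Z where "Z = int c ^ m * int k * t ^ Suc m + int (Suc m) * N"
    have TZ: "T = fact m * of_int Z" unfolding N Z_def t by simp
    have "Z \<noteq> 0"
    proof
      assume "Z = 0"
      hence "int c ^ m * int k * t ^ Suc m = int (Suc m) * (- N)" by (simp add: Z_def)
      hence "int (Suc m) dvd int c ^ m * int k * t ^ Suc m" by (metis dvd_triv_left)
      also have "int c ^ m * int k * t ^ Suc m dvd D ^ Suc m"
        unfolding D_def power_mult_distrib by (intro mult_dvd_mono le_imp_power_dvd dvd_refl) auto
      finally have "int (Suc m) dvd D ^ Suc m" .
      moreover have "coprime (int (Suc m)) (D ^ Suc m)"
      proof -
        have "D dvd int m" using m by simp
        moreover have "coprime (int (Suc m)) (int m)"
          using coprime_Suc_left_nat[of m] by (simp only: coprime_int_iff)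
        ultimately have "coprime (int (Suc m)) D" by (meson coprime_divisors dvd_refl)
        thus ?thesis by simp
      qed
      ultimately have "int (Suc m) = 1" using coprime_common_divisor_int by fastforce
      thus False using m \<open>D \<noteq> 0\<close> by simp
    qed
    hence "\<bar>Z\<bar> \<ge> 1" by simp
    hence "1 \<le> real_of_int \<bar>Z\<bar>" by linarith
    hence lower: "fact m \<le> norm T" unfolding TZ norm_mult by simp
    have B: "norm (poly H (of_nat c * z)) \<le> K ^ m * L ^ Suc m" if "norm z \<le> r" for z
      unfolding H_def poly_mult poly_monom poly_power norm_mult norm_power mult_1 K_def
      using that L r0 by (intro mult_mono power_mono) (auto intro!: mult_left_mono simp: norm_mult)
    have "T = (\<Sum>j\<in>J. hermite_sum H (of_nat c) (\<beta> j) - exp (\<beta> j) * hermite_sum H (of_nat c) 0)"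
      unfolding T_def sum_subtractf sum_distrib_right[symmetric] exp0 by simp
    also have "norm \<dots> \<le> (\<Sum>j\<in>J. exp r * (exp r * (K ^ m * L ^ Suc m) * r))"
      by (intro sum_norm_le hermite_sum_exp_approx B r)
    also have "\<dots> = A * (K * L) ^ m"
      by (simp add: A_def power_mult_distrib)
    finally show ?thesis using lower by linarith
  qed
  have "(\<lambda>m. (K * L) ^ m / fact m) \<longlonglongrightarrow> 0"
    using summable_LIMSEQ_zero[OF summable_exp[of "K * L"]] by (simp add: field_simps)
  hence "(\<lambda>m. A * ((K * L) ^ m / fact m)) \<longlonglongrightarrow> 0" by (rule tendsto_mult_right_zero)
  hence "eventually (\<lambda>m. A * ((K * L) ^ m / fact m) < 1) sequentially"
    by (rule order_tendstoD) simp
  then obtain s where s: "\<And>m. m \<ge> s \<Longrightarrow> A * ((K * L) ^ m / fact m) < 1"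
    unfolding eventually_sequentially by blast
  define m where "m = nat \<bar>D\<bar> * Suc s"
  have "m \<ge> s" using \<open>D \<noteq> 0\<close> unfolding m_def
    by (metis le_trans le_SucI mult_le_mono1 nat_mult_1 Suc_leI order_refl zero_less_abs_iff zero_less_nat_eq One_nat_def)
  from s[OF this] have "A * (K * L) ^ m < fact m" by (simp add: field_simps)
  with bound[OF m_def] show False by simp
qed

text \<open>
  If \<open>exp x = -1\<close> for a member \<open>x\<close> of a family \<open>(a\<^sub>i)\<close> with rational power sums, then the product
  \<open>\<Prod>\<^sub>i (exp a\<^sub>i + 1)\<close> vanishes. Expanded, it is the sum of the exponentials of all subset sums, and the
  empty subset supplies the member \<open>0\<close> that \<open>exp_sum_nonzero\<close> asks for.
\<close>
lemma algebraic_imp_exp_neq_minus_one: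
  assumes "algebraic (x :: complex)"
  shows "exp x \<noteq> - 1"
proof
  assume x: "exp x = - 1"
  obtain I :: "nat set" and a where a: "finite I" "x \<in> a ` I" "\<And>k. (\<Sum>i\<in>I. a i ^ k) \<in> \<rat>"
    using algebraic_imp_rational_power_sums[OF assms] by metis
  have "(\<Sum>S\<in>Pow I. exp (\<Sum>i\<in>S. a i)) = (\<Prod>i\<in>I. exp (a i) + 1)"
    by (subst prod_add[OF a(1)], intro sum.cong) (auto simp: exp_sum finite_subset[OF _ a(1)])
  also have "\<dots> = 0" using a(1,2) x by (auto simp: add_eq_0_iff2)
  finally have "(\<Sum>S\<in>Pow I. exp (\<Sum>i\<in>S. a i)) = 0" .
  moreover have "(\<Sum>S\<in>Pow I. exp (\<Sum>i\<in>S. a i)) \<noteq> 0"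
    by (rule exp_sum_nonzero[where ?j0.0 = "{}"])
       (use a in \<open>auto intro: subset_sums_rational_power_sums\<close>)
  ultimately show False by contradiction
qed

lemma transcendental_pi_squared: "\<not> algebraic (complex_of_real pi ^ 2)"
proof
  assume "algebraic (complex_of_real pi ^ 2)"
  hence "algebraic (- (complex_of_real pi ^ 2))" by simp
  hence "algebraic (\<i> * of_real pi)"
    by (rule algebraic_root[where p = "monom 1 2"])
       (auto simp: poly_monom power_mult_distrib coeff_monom degree_monom_eq)
  from algebraic_imp_exp_neq_minus_one[OF this] show False by simp
qed

section \<open>A functional that vanishes on the algebraic numbers\<close>

text \<open>
  The algebraic numbers form a rational subspace. A basis of it together with \<open>x\<close> is still independent,
  so the values on it can be prescribed.
\<close>
lemma exists_rational_functional:
  assumes x: "\<not> algebraic x"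
  shows "\<exists>\<phi> :: complex \<Rightarrow> rat. (\<forall>u v. \<phi> (u + v) = \<phi> u + \<phi> v) \<and> (\<forall>q u. \<phi> (of_rat q * u) = q * \<phi> u) \<and>
      (\<forall>u. algebraic u \<longrightarrow> \<phi> u = 0) \<and> \<phi> x = 1"
proof -
  interpret C: vector_space "\<lambda>(q :: rat) (u :: complex). of_rat q * u"
    by standard (auto simp: algebra_simps of_rat_add of_rat_mult)
  interpret CQ: vector_space_pair "\<lambda>(q :: rat) (u :: complex). of_rat q * u" "(*) :: rat \<Rightarrow> rat \<Rightarrow> rat"
    by standard (auto simp: algebra_simps)
  obtain B where B: "B \<subseteq> {u. algebraic u}" "C.independent B" "C.span B = C.span {u. algebraic u}"
    using C.basis_exists[of "{u. algebraic u}"] by (metis C.span_mono C.span_span C.span_superset subset_antisym)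
  have "C.subspace {u :: complex. algebraic u}"
    by (rule C.subspaceI) (auto intro: algebraic_add algebraic_mult[OF rat_imp_algebraic])
  hence span: "C.span B = {u. algebraic u}" using B(3) by simp
  have "C.independent (insert x B)"
    using x B(2) span by (intro C.independent_insertI) auto
  then obtain \<phi> where \<phi>: "Vector_Spaces.linear (\<lambda>(q :: rat) (u :: complex). of_rat q * u) ((*) :: rat \<Rightarrow> rat \<Rightarrow> rat) \<phi>"
     "\<forall>u\<in>insert x B. \<phi> u = (if u = x then 1 else 0)"
    using CQ.linear_independent_extend[of "insert x B" "\<lambda>u. if u = x then 1 else 0"] by blast
  interpret \<phi>: Vector_Spaces.linear "\<lambda>(q :: rat) (u :: complex). of_rat q * u" "(*) :: rat \<Rightarrow> rat \<Rightarrow> rat" \<phi> by fact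
  have "\<phi> u = 0" if "u \<in> B" for u
    using that x B(1) \<phi>(2) by auto
  hence "\<phi> u = 0" if "algebraic u" for u
    by (rule \<phi>.eq_0_on_span[of B]) (use that span in blast)+
  moreover have "\<phi> x = 1" using \<phi>(2) by simp
  ultimately show ?thesis using \<phi>.add \<phi>.scale by blast
qed

section \<open>Derivatives of the Gamma function at the positive integers\<close>

text \<open>
  The \<open>n\<close>-th derivative of the functional equation. For \<open>n = 0\<close> the second summand carries the factor 0,
  so the truncated order \<open>n - 1\<close> is harmless.
\<close>
lemma higher_deriv_Gamma_plus1:
  assumes "Re z > 0"
  shows "(deriv ^^ n) Gamma (z + 1) = z * (deriv ^^ n) Gamma z + of_nat n * (deriv ^^ (n - 1)) Gamma (z :: complex)"
  using assms
proof (induction n arbitrary: z)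
  case 0
  hence "z \<notin> \<int>\<^sub>\<le>\<^sub>0" by (auto elim!: nonpos_Ints_cases)
  thus ?case by (simp add: Gamma_plus1)
next
  case (Suc n)
  define S where "S = {z :: complex. Re z > 0}"
  have S: "open S" unfolding S_def by (rule open_halfspace_Re_gt)
  have hol: "Gamma holomorphic_on S"
    by (rule holomorphic_Gamma) (auto simp: S_def elim!: nonpos_Ints_cases)
  have D: "((deriv ^^ k) Gamma has_field_derivative (deriv ^^ Suc k) Gamma w) (at w)" if "w \<in> S" for k w
    using has_field_derivative_higher_deriv[OF hol S that] by simp
  have z: "z \<in> S" "z + 1 \<in> S" using Suc.prems by (auto simp: S_def)
  have "((\<lambda>w. (deriv ^^ n) Gamma (w + 1)) has_field_derivative (deriv ^^ Suc n) Gamma (z + 1)) (at z)"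
    using DERIV_shift[of "(deriv ^^ n) Gamma"] D[OF z(2)] by blast
  moreover have "((\<lambda>w. (deriv ^^ n) Gamma (w + 1)) has_field_derivative
      z * (deriv ^^ Suc n) Gamma z + of_nat (Suc n) * (deriv ^^ n) Gamma z) (at z)"
  proof (rule has_field_derivative_transform_within_open[OF _ S z(1)])
    show "((\<lambda>w. w * (deriv ^^ n) Gamma w + of_nat n * (deriv ^^ (n - 1)) Gamma w) has_field_derivative
      z * (deriv ^^ Suc n) Gamma z + of_nat (Suc n) * (deriv ^^ n) Gamma z) (at z)"
    proof (cases n)
      case 0
      have "(Gamma has_field_derivative deriv Gamma z) (at z)"
        using D[OF z(1), of 0] by simp
      from DERIV_mult[OF DERIV_ident this] show ?thesis unfolding 0 by (simp add: ac_simps)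
    next
      case (Suc k)
      show ?thesis unfolding Suc diff_Suc_1
        by (rule derivative_eq_intros D z refl)+ (simp add: algebra_simps)
    qed
    show "w * (deriv ^^ n) Gamma w + of_nat n * (deriv ^^ (n - 1)) Gamma w = (deriv ^^ n) Gamma (w + 1)"
      if "w \<in> S" for w using Suc.IH[of w] that by (simp add: S_def)
  qed
  ultimately show ?case by (simp add: DERIV_unique)
qed

lemma deriv_Gamma_1: "(deriv ^^ 1) Gamma 1 = (- euler_mascheroni :: complex)"
  using DERIV_imp_deriv[OF has_field_derivative_Gamma[of "1 :: complex"]] by simp

text \<open>
  Differentiating \<open>\<Gamma>' = \<Gamma> \<psi>\<close> once more at 1 gives \<open>\<psi>(1)\<^sup>2 + \<psi>'(1)\<close>, and \<open>\<psi>'(1) = \<Sum>\<^sub>n 1/n\<^sup>2\<close>.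
\<close>
lemma deriv2_Gamma_1:
  "(deriv ^^ 2) Gamma 1 = ((deriv ^^ 1) Gamma 1)\<^sup>2 + (complex_of_real pi)\<^sup>2 / 6"
proof -
  define S where "S = {z :: complex. Re z > 0}"
  have S: "open S" unfolding S_def by (rule open_halfspace_Re_gt)
  have nz: "w \<notin> \<int>\<^sub>\<le>\<^sub>0" if "w \<in> S" for w
    using that by (auto simp: S_def elim!: nonpos_Ints_cases)
  have d1: "deriv Gamma w = Gamma w * Digamma w" if "w \<in> S" for w
    using nz[OF that] by (intro DERIV_imp_deriv has_field_derivative_Gamma)
  have one: "1 \<in> S" by (simp add: S_def)
  have "((\<lambda>w. Gamma w * Digamma w) has_field_derivative (Digamma 1 ^ 2 + Polygamma 1 1)) (at (1 :: complex))"
    using nz[OF one] by (auto intro!: derivative_eq_intros simp: power2_eq_square)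
  hence "(deriv Gamma has_field_derivative (Digamma 1 ^ 2 + Polygamma 1 1)) (at (1 :: complex))"
    by (rule has_field_derivative_transform_within_open[OF _ S one]) (simp add: d1)
  hence "(deriv ^^ 2) Gamma 1 = Digamma 1 ^ 2 + Polygamma 1 (1 :: complex)"
    by (simp add: numeral_2_eq_2 DERIV_imp_deriv)
  moreover have "Polygamma 1 (1 :: complex) = of_real (pi\<^sup>2 / 6)"
  proof -
    have "(\<lambda>n. of_real (1 / (real n + 1)\<^sup>2)) sums complex_of_real (pi\<^sup>2 / 6)"
      using inverse_squares_sums by (subst sums_of_real_iff) (simp add: add.commute)
    hence "(\<Sum>n. inverse ((1 + of_nat n) ^ Suc 1)) = complex_of_real (pi\<^sup>2 / 6)"
      by (intro sums_unique[symmetric]) (simp add: power2_eq_square field_simps)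
    thus ?thesis by (simp add: Polygamma_def)
  qed
  ultimately show ?thesis by (simp add: deriv_Gamma_1[simplified])
qed

lemma Gamma_deriv_1_or_2_transcendental:
  "\<not> algebraic ((deriv ^^ 1) Gamma (1 :: complex)) \<or> \<not> algebraic ((deriv ^^ 2) Gamma (1 :: complex))"
proof (rule ccontr)
  assume "\<not> ?thesis"
  hence a: "algebraic ((deriv ^^ 1) Gamma (1 :: complex))" "algebraic ((deriv ^^ 2) Gamma (1 :: complex))"
    by auto
  have "(complex_of_real pi)\<^sup>2 = 6 * ((deriv ^^ 2) Gamma 1 + (- ((deriv ^^ 1) Gamma 1 * (deriv ^^ 1) Gamma 1)))"
    unfolding deriv2_Gamma_1 by (simp add: power2_eq_square)
  also have "algebraic \<dots>"
    by (intro algebraic_mult[of 6] algebraic_add algebraic_minus algebraic_mult[of "(deriv ^^ 1) Gamma 1"] a) auto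
  finally show False using transcendental_pi_squared by simp
qed

section \<open>A discrete form of Rolle's theorem\<close>

text \<open>
  The points are listed in decreasing order. If \<open>G\<^sub>d\<^sub>+\<^sub>j\<close> has weakly alternating signs at \<open>j + 1\<close> points, then
  between two neighbouring points its difference sequence, hence \<open>G\<^sub>d\<^sub>+\<^sub>j\<^sub>-\<^sub>1\<close>, takes a value of the sign that
  is forced by the total change; this gives \<open>j\<close> weakly alternating values of \<open>G\<^sub>d\<^sub>+\<^sub>j\<^sub>-\<^sub>1\<close>. The sign at the
  largest point is prescribed to be \<open>\<le> 0\<close>, which after \<open>j\<close> steps contradicts the positivity of \<open>G\<^sub>d\<close>.
  Weak inequalities are what makes the descent work: zeros satisfy any prescribed alternation.
\<close>
lemma alternating_values_impossible:
  fixes G :: "nat \<Rightarrow> nat \<Rightarrow> rat"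
  assumes step: "\<And>k m. of_nat (Suc m) * (G (Suc k) (Suc m) - G (Suc k) m) = of_nat (Suc k) * G k m"
    and pos: "\<And>m. G d m > 0"
    and x: "\<And>i. i < j \<Longrightarrow> x (Suc i) < x i" "\<And>i. i \<le> j \<Longrightarrow> (-1) ^ i * G (d + j) (x i) \<le> 0"
  shows False
  using x
proof (induction j arbitrary: x)
  case 0
  thus ?case using pos[of "x 0"] by force
next
  case (Suc j)
  \<comment> \<open>A sum of increments that is \<open>\<le> 0\<close> has a summand \<open>\<le> 0\<close>.\<close>
  have "\<exists>y. x (Suc i) \<le> y \<and> y < x i \<and> (-1) ^ i * G (d + j) y \<le> 0" if i: "i \<le> j" for i
  proof -
    let ?f = "\<lambda>m. (-1) ^ i * G (d + Suc j) m"
    have lt: "x (Suc i) < x i" using Suc.prems(1)[of i] i by simp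
    have "?f (x i) \<le> 0" "?f (x (Suc i)) \<ge> 0"
      using Suc.prems(2)[of i] Suc.prems(2)[of "Suc i"] i by auto
    moreover have "?f (x i) - ?f (x (Suc i)) = (\<Sum>m = x (Suc i)..<x i. ?f (Suc m) - ?f m)"
      by (rule sum_Suc_diff'[symmetric]) (use lt in simp)
    ultimately have "(\<Sum>m = x (Suc i)..<x i. ?f (Suc m) - ?f m) \<le> 0" by linarith
    moreover have "(\<Sum>m = x (Suc i)..<x i. ?f (Suc m) - ?f m) > 0"
      if "\<forall>y\<in>{x (Suc i)..<x i}. ?f (Suc y) - ?f y > 0"
      by (rule sum_pos) (use that lt in auto)
    ultimately obtain y where y: "y \<in> {x (Suc i)..<x i}" "?f (Suc y) - ?f y \<le> 0"
      by (meson not_le)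
    have "of_nat (Suc (d + j)) * ((-1) ^ i * G (d + j) y) = of_nat (Suc y) * (?f (Suc y) - ?f y)"
      using arg_cong[OF step[of y "d + j"], of "\<lambda>t. (-1) ^ i * t"] by (simp add: algebra_simps)
    also have "\<dots> \<le> 0" using y(2) by (intro mult_nonneg_nonpos) auto
    finally have "(-1) ^ i * G (d + j) y \<le> 0"
      by (simp add: mult_le_0_iff del: of_nat_Suc)
    thus ?thesis using y(1) by auto
  qed
  then obtain y where y: "\<And>i. i \<le> j \<Longrightarrow> x (Suc i) \<le> y i \<and> y i < x i \<and> (-1) ^ i * G (d + j) (y i) \<le> 0"
    by metis
  show ?case
  proof (rule Suc.IH[of y])
    show "y (Suc i) < y i" if "i < j" for i
      using y[of i] y[of "Suc i"] that by auto
  qed (use y in auto)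
qed

lemma descending_enumeration:
  fixes Z :: "nat set"
  assumes "finite Z" "card Z = Suc j"
  obtains x where "\<And>i. i < j \<Longrightarrow> x (Suc i) < x i" "\<And>i. i \<le> j \<Longrightarrow> x i \<in> Z"
proof -
  define xs where "xs = rev (sorted_list_of_set Z)"
  have len: "length xs = Suc j" using assms by (simp add: xs_def)
  have "sorted_wrt (>) xs"
    unfolding xs_def sorted_wrt_rev by simp
  show ?thesis
  proof (rule that[of "(!) xs"])
    show "xs ! Suc i < xs ! i" if "i < j" for i
      using \<open>sorted_wrt (>) xs\<close> that len by (auto simp: sorted_wrt_iff_nth_less)
    show "xs ! i \<in> Z" if "i \<le> j" for i
      using nth_mem[of i xs] that len assms by (simp add: xs_def)
  qed
qed

text \<open>
  Let \<open>d\<close> be the least index with \<open>G\<^sub>d(0) \<noteq> 0\<close>. All sequences before \<open>G\<^sub>d\<close> vanish identically, so \<open>G\<^sub>d\<close> is a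
  nonzero constant, and \<open>d \<ge> 1\<close>. After a change of sign the constant is positive, and \<open>n - d + 1\<close> zeros
  of \<open>G\<^sub>n\<close> would be alternating values.
\<close>
lemma card_zeros_le:
  fixes G :: "nat \<Rightarrow> nat \<Rightarrow> rat"
  assumes step: "\<And>k m. of_nat (Suc m) * (G (Suc k) (Suc m) - G (Suc k) m) = of_nat (Suc k) * G k m"
    and G0: "\<And>m. G 0 m = 0" and l: "G l 0 \<noteq> 0" "l \<le> n"
    and Z: "finite Z" "\<And>m. m \<in> Z \<Longrightarrow> G n m = 0"
  shows "card Z < n"
proof (rule ccontr)
  assume "\<not> card Z < n"
  define d where "d = (LEAST k. G k 0 \<noteq> 0)"
  have d: "G d 0 \<noteq> 0" "d \<le> l" unfolding d_def using l LeastI[of "\<lambda>k. G k 0 \<noteq> 0" l] by (auto intro: Least_le)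
  have below: "G k 0 = 0" if "k < d" for k using that not_less_Least unfolding d_def by blast
  have below_all: "G k m = 0" if "k < d" for k m
    using that
  proof (induction k arbitrary: m)
    case (Suc k)
    show ?case
    proof (induction m)
      case (Suc m)
      have "of_nat (Suc m) * (G (Suc k) (Suc m) - G (Suc k) m) = 0"
        using step[of m k] Suc.prems \<open>Suc k < d\<close> Suc.IH \<open>\<And>m. k < d \<Longrightarrow> G k m = 0\<close> by simp
      thus ?case using Suc by (simp del: of_nat_Suc)
    qed (use below Suc.prems in auto)
  qed (use G0 in auto)
  obtain e where e: "d = Suc e" using d(1) G0 by (cases d) auto
  have const: "G d m = G d 0" for m
  proof (induction m)
    case (Suc m)
    have "of_nat (Suc m) * (G d (Suc m) - G d m) = 0"
      using step[of m e] below_all[of e m] e by simp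
    thus ?case using Suc by (simp del: of_nat_Suc)
  qed auto
  define j where "j = n - d"
  have n: "n = d + j" using d l by (simp add: j_def)
  have "Suc j \<le> card Z" using \<open>\<not> card Z < n\<close> n e by simp
  then obtain Z' where Z': "Z' \<subseteq> Z" "card Z' = Suc j" "finite Z'"
    by (meson obtain_subset_with_card_n)
  obtain x where x: "\<And>i. i < j \<Longrightarrow> x (Suc i) < x i" "\<And>i. i \<le> j \<Longrightarrow> x i \<in> Z'"
    using descending_enumeration[OF Z'(3,2)] by blast
  define s where "s = sgn (G d 0)"
  show False
  proof (rule alternating_values_impossible[of "\<lambda>k m. s * G k m" d j x])
    show "of_nat (Suc m) * (s * G (Suc k) (Suc m) - s * G (Suc k) m) = of_nat (Suc k) * (s * G k m)" for k m
      using arg_cong[OF step[of m k], of "\<lambda>t. s * t"] by (simp add: algebra_simps)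
    show "s * G d m > 0" for m using d(1) const[of m] by (simp add: s_def sgn_mult_self_eq mult.commute flip: abs_sgn)
    show "(- 1) ^ i * (s * G (d + j) (x i)) \<le> 0" if "i \<le> j" for i
      using x(2)[OF that] Z' Z(2) n by auto
  qed (use x in auto)
qed

section \<open>Counting transcendental values\<close>

lemma Gamma_derivs_algebraic_card:
  assumes n: "n \<ge> 2" and Z: "finite Z" "\<And>m. m \<in> Z \<Longrightarrow> m \<ge> 1 \<and> algebraic ((deriv ^^ n) Gamma (of_nat m :: complex))"
  shows "card Z < n"
proof -
  obtain l where l: "l = 1 \<or> l = 2" "\<not> algebraic ((deriv ^^ l) Gamma (1 :: complex))"
    using Gamma_deriv_1_or_2_transcendental by metis
  obtain \<phi> :: "complex \<Rightarrow> rat" where \<phi>: "\<And>u v. \<phi> (u + v) = \<phi> u + \<phi> v" "\<And>q u. \<phi> (of_rat q * u) = q * \<phi> u"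
      "\<And>u. algebraic u \<Longrightarrow> \<phi> u = 0" "\<phi> ((deriv ^^ l) Gamma 1) = 1"
    using exists_rational_functional[OF l(2)] by blast
  have \<phi>_nat: "\<phi> (of_nat k * u) = of_nat k * \<phi> u" for k u
    using \<phi>(2)[of "of_nat k" u] by simp
  \<comment> \<open>Division by \<open>m!\<close> absorbs the factor from \<open>\<Gamma>(z + 1) = z \<Gamma>(z)\<close>, so that the recursion speaks of differences.\<close>
  define G where "G = (\<lambda>k m. \<phi> ((deriv ^^ k) Gamma (of_nat (Suc m))) / fact m)"
  have "card ((\<lambda>m. m - 1) ` Z) < n"
  proof (rule card_zeros_le[of G l])
    fix k m
    have "(deriv ^^ Suc k) Gamma (of_nat (Suc (Suc m)) :: complex) =
          of_nat (Suc m) * (deriv ^^ Suc k) Gamma (of_nat (Suc m)) + of_nat (Suc k) * (deriv ^^ k) Gamma (of_nat (Suc m))"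
      using higher_deriv_Gamma_plus1[of "of_nat (Suc m)" "Suc k"] by (simp add: add_ac)
    hence "\<phi> ((deriv ^^ Suc k) Gamma (of_nat (Suc (Suc m)))) =
          of_nat (Suc m) * \<phi> ((deriv ^^ Suc k) Gamma (of_nat (Suc m))) + of_nat (Suc k) * \<phi> ((deriv ^^ k) Gamma (of_nat (Suc m)))"
      by (simp only: \<phi>(1) \<phi>_nat)
    thus "of_nat (Suc m) * (G (Suc k) (Suc m) - G (Suc k) m) = of_nat (Suc k) * G k m"
      unfolding G_def fact_Suc by (simp add: divide_simps del: of_nat_Suc funpow.simps)
  next
    \<comment> \<open>\<open>\<Gamma>(m + 1) = m!\<close> is algebraic.\<close>
    show "G 0 m = 0" for m
      using \<phi>(3)[of "Gamma (of_nat (Suc m))"] by (simp add: G_def Gamma_fact rat_imp_algebraic fact_in_Rats)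
    show "G l 0 \<noteq> 0" using \<phi>(4) by (simp add: G_def)
    show "l \<le> n" using l n by auto
    show "G n m = 0" if "m \<in> (\<lambda>m. m - 1) ` Z" for m
      using that Z(2) \<phi>(3) by (force simp: G_def)
  qed (use Z in auto)
  moreover have "inj_on (\<lambda>m. m - 1) Z"
    using Z(2) by (intro inj_onI) (metis le_add_diff_inverse)
  ultimately show ?thesis by (simp add: card_image)
qed

lemma transcendental_pairs_count:
  "(\<Sum>n\<in>{2..N}. M - (n - 1)) \<le> card {(n, m). n \<in> {2..N} \<and> m \<in> {1..M} \<and>
                   transcendental ((deriv ^^ n) Gamma (of_nat m))}"
proof -
  define T where "T = (\<lambda>n. {m \<in> {1..M}. transcendental ((deriv ^^ n) Gamma (of_nat m))})"
  have "{(n, m). n \<in> {2..N} \<and> m \<in> {1..M} \<and> transcendental ((deriv ^^ n) Gamma (of_nat m))} = Sigma {2..N} T"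
    by (auto simp: T_def)
  hence "card {(n, m). n \<in> {2..N} \<and> m \<in> {1..M} \<and> transcendental ((deriv ^^ n) Gamma (of_nat m))}
          = (\<Sum>n\<in>{2..N}. card (T n))"
    by (simp add: card_SigmaI T_def)
  moreover have "M - (n - 1) \<le> card (T n)" if "n \<in> {2..N}" for n
  proof -
    have "card ({1..M} - T n) < n"
      using that by (intro Gamma_derivs_algebraic_card) (auto simp: T_def transcendental_def)
    moreover have "card ({1..M} - T n) = M - card (T n)"
      by (subst card_Diff_subset) (auto simp: T_def)
    ultimately show ?thesis by linarith
  qed
  ultimately show ?thesis by (simp only: sum_mono)
qed

text \<open>
  Adding the order \<open>N + 1\<close> contributes \<open>M - N\<close> truncated at 0, so the sum stays constant from \<open>N = M\<close> on.
  The two closed forms agree for \<open>M = N\<close>, which lets the induction cross the diagonal.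
\<close>
lemma sum_truncated_differences:
  "real (\<Sum>n\<in>{2..N}. M - (n - 1)) = 
     (if M \<le> N - 1 then real M * (real M - 1) / 2 else (real N - 1) * (real M - real N / 2))"
  if "N \<ge> 1"
  using that
proof (induction N rule: nat_induct_at_least)
  case (Suc N)
  have eq: "{2..Suc N} = insert (Suc N) {2..N}" using Suc.hyps by auto
  have "real (\<Sum>n\<in>{2..Suc N}. M - (n - 1)) = real (M - N) + real (\<Sum>n\<in>{2..N}. M - (n - 1))"
    unfolding eq by simp
  also have "\<dots> = (if M \<le> Suc N - 1 then real M * (real M - 1) / 2 else (real (Suc N) - 1) * (real M - real (Suc N) / 2))"
    unfolding Suc.IH using Suc.hyps by (cases "M = N") (auto simp: field_simps of_nat_diff)
  finally show ?case .
qed auto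

lemma transc_density_ge:
  assumes "N \<ge> 2" "M \<ge> 1"
  shows "transc_density N M \<ge> density_bound N M"
proof -
  define C where "C = real (card {(n, m). n \<in> {2..N} \<and> m \<in> {1..M} \<and>
                   transcendental ((deriv ^^ n) Gamma (of_nat m))})"
  have pos: "real N - 1 > 0" "real M > 0" using assms by auto
  have "density_bound N M * ((real N - 1) * real M) = real (\<Sum>n\<in>{2..N}. M - (n - 1))"
  proof (cases "M \<le> N - 1")
    case True
    hence "real M \<le> real N - 1" using assms by linarith
    thus ?thesis using True pos assms
      by (subst sum_truncated_differences) (auto simp: density_bound_def field_simps)
  next
    case False
    hence "\<not> real M \<le> real N - 1" using assms by linarith
    thus ?thesis using False pos assms
      by (subst sum_truncated_differences) (auto simp: density_bound_def field_simps)
  qed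
  also have "\<dots> \<le> C" using transcendental_pairs_count[of M N] unfolding C_def by linarith
  finally have "density_bound N M \<le> C / ((real N - 1) * real M)"
    using pos by (simp add: pos_le_divide_eq)
  thus ?thesis by (simp add: transc_density_def C_def)
qed

text \<open>
  On the diagonal \<open>M = N\<close> the two definitions use different branches, but both values are \<open>1/2\<close>. In all
  cases the quotient lies between \<open>1 - 1/M\<close> and \<open>1 + 1/(N - 1)\<close>.
\<close>
lemma density_bound_asymptotics:
  "(\<lambda>(N, M). density_bound N M) \<sim>[at_top \<times>\<^sub>F at_top] (\<lambda>(N, M). density_bound_asymp N M)"
proof (rule asymp_equivI')
  let ?F = "at_top \<times>\<^sub>F at_top :: (nat \<times> nat) filter"
  let ?q = "\<lambda>x :: nat \<times> nat. (case x of (N, M) \<Rightarrow> density_bound N M) / (case x of (N, M) \<Rightarrow> density_bound_asymp N M)"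
  have ev: "eventually (\<lambda>x. fst x \<ge> 2 \<and> snd x \<ge> 2) ?F"
    using eventually_prodI[OF eventually_ge_at_top[of "2 :: nat"] eventually_ge_at_top[of "2 :: nat"]]
    by (simp add: case_prod_unfold)
  have bounds: "1 - 1 / real M \<le> ?q (N, M) \<and> ?q (N, M) \<le> 1 + 1 / (real N - 1)" if "N \<ge> 2" "M \<ge> 2" for N M
  proof -
    have nm: "real N \<ge> 2" "real M \<ge> 2" using that by auto
    consider "M \<le> N - 1" | "M = N" | "M > N" using that by linarith
    thus ?thesis
    proof cases
      case 1
      hence MN: "real M \<le> real N - 1" using that by linarith
      hence q: "?q (N, M) = (1 - 1 / real M) * (1 + 1 / (real N - 1))"
        using nm by (simp add: density_bound_def density_bound_asymp_def field_simps)
      have "1 - 1 / real M \<ge> 0" "1 / (real N - 1) \<ge> 0" "1 / real M \<ge> 0" using nm by auto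
      thus ?thesis unfolding q
        using mult_left_mono[of 1 "1 + 1 / (real N - 1)" "1 - 1 / real M"]
              mult_right_mono[of "1 - 1 / real M" 1 "1 + 1 / (real N - 1)"] by auto
    next
      case 2
      hence "?q (N, M) = 1" using nm by (simp add: density_bound_def density_bound_asymp_def)
      thus ?thesis using nm by auto
    next
      case 3
      hence "real M > real N" by simp
      hence "?q (N, M) = 1" using nm by (auto simp add: density_bound_def density_bound_asymp_def field_simps)
      thus ?thesis using nm by auto
    qed
  qed
  show "(?q \<longlongrightarrow> 1) ?F"
  proof (rule tendsto_sandwich)
    show "eventually (\<lambda>x. 1 - 1 / real (snd x) \<le> ?q x) ?F"
      using ev by eventually_elim (use bounds in force)
    show "eventually (\<lambda>x. ?q x \<le> 1 + 1 / (real (fst x) - 1)) ?F"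
      using ev by eventually_elim (use bounds in force)
    have "(\<lambda>n. 1 - 1 / real n) \<longlonglongrightarrow> 1" "(\<lambda>n. 1 + 1 / (real n - 1)) \<longlonglongrightarrow> 1"
      by real_asymp+
    thus "((\<lambda>x. 1 - 1 / real (snd x)) \<longlongrightarrow> 1) ?F" "((\<lambda>x. 1 + 1 / (real (fst x) - 1)) \<longlongrightarrow> 1) ?F"
      by (auto intro: filterlim_compose filterlim_fst filterlim_snd)
  qed
qed

theorem theorem3:
  "(\<forall>N\<ge>2. \<forall>M\<ge>1. transc_density N M \<ge> density_bound N M) \<and>
   (\<lambda>(N, M). density_bound N M) \<sim>[at_top \<times>\<^sub>F at_top] (\<lambda>(N, M). density_bound_asymp N M)"
  using transc_density_ge density_bound_asymptotics by blast

end
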